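(* Let $d\in\mathbb{N}$, let $c>0$ be a fixed constant, and let $0<\epsilon\le 1/d$. Let $\sigma:\mathbb{R}^d\to\mathbb{R}$ be a twice-differentiable function satisfying $\int_{\mathbb{R}^d}\sigma(x)\,dx=1$ and, for every $x\in\mathbb{R}^d$, $\sigma(-x)=\sigma(x)$ and $$\|\nabla_x^j\sigma(x)\|\le \frac{C'}{\left(c^{-1}+\|x\|^d\right)^{1+\epsilon+j/d}},\qquad j=0,1,2,$$ with some constant $C'>0$. Let $\psi_{k,b}$ and $\mathcal{L}_1$ be associated with $\sigma$ as in the context, and let $\sigma^\dagger\in L^2(\mathbb{R}^d)$ be arbitrary. Let $f\in\mathcal{L}_1$, $N\in\mathbb{N}$, and let $$f_N=\sum_{(k,b)\in\Lambda}\chi_N(k,b)\,c_{k,b}\,\psi_{k,b},$$ where $c_{k,b}\in\mathbb{R}$ and $\chi_N(k,b)$ equals $1$ for at most $N$ indices $(k,b)\in\Lambda$ and is $0$ otherwise, be such that $\|f-f_N\|_{L^2}\le\|f\|_{\mathcal{L}_1}(N+1)^{-1/2}$. Then there exist $\gamma_1,\dots,\gamma_{2N}\in\mathbb{R}$, $\alpha_1,\dots,\alpha_{2N}\in\mathbb{R}$ and $\vec\theta_1,\dots,\vec\theta_{2N}\in\mathbb{R}^d$ such that the function $$\Psi(\vec x)=\sum_{n=1}^{2N}\alpha_n\,\sigma^\dagger(\gamma_n\vec x+\vec\theta_n),\qquad\vec x\in\mathbb{R}^d,$$ satisfies $$\|f-\Psi\|_{L^2}\le\|f\|_{\mathcal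{L}_1}(N+1)^{-1/2}+\operatorname{dist}(\sigma,\sigma^\dagger)\sum_{(k,b)\in\Lambda}\chi_N(k,b)\,|c_{k,b}|.$$
   Context: $\|x\|$ is the Euclidean norm on $\mathbb{R}^d$; $\nabla^0\sigma=\sigma$, $\nabla^1\sigma$ is the gradient and $\nabla^2\sigma$ the Hessian; $L^2=L^2(\mathbb{R}^d)$ with Lebesgue measure. For $k\in\mathbb{Z}$ and $x,b\in\mathbb{R}^d$ put $$S_k(x,b)=2^k\sigma(2^{k/d}(x-b)),\qquad \psi_{k,b}(x)=2^{-k/2}\left(S_k(x,b)-S_{k-1}(x,b)\right).$$ Let $\Lambda=\{(k,b)\in\mathbb{Z}\times\mathbb{R}^d: b\in 2^{-k/d}\mathbb{Z}^d\}$. For $f\in L^2(\mathbb{R}^d)$ define $$\|f\|_{\mathcal{L}_1}=\inf\Big\{\sum_{(k,b)\in\Lambda}|c_{k,b}| : f=\sum_{(k,b)\in\Lambda}c_{k,b}\psi_{k,b}\Big\}$$ (expansions in $L^2$; infimum of the empty set is $\infty$), and $\mathcal{L}_1=\{f\in L^2(\mathbb{R}^d):\|f\|_{\mathcal{L}_1}<\infty\}$. For $\sigma_1,\sigma_2\in L^2(\mathbb{R}^d)$, $\operatorname{dist}(\sigma_1,\sigma_2)=\left(1+\frac{1}{\sqrt2}\right)\|\sigma_1-\sigma_2\|_{L^2}$. The function $\Psi$ is called a (shallow) scalar-Weight vector-Bias neural network with activation function $\sigma^\dagger$. *)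

theory Defs
  imports "HOL-Analysis.Analysis"
begin

text \<open>
  \<open>\<real>\<^sup>d\<close> is \<^typ>\<open>real ^ 'd\<close>, with \<open>d\<close> being \<^term>\<open>CARD('d)\<close>.  Elements of \<open>L\<^sup>2\<close> are
  represented by Lebesgue measurable functions, not by classes modulo null sets.
\<close>

definition L2_space :: "('a::euclidean_space \<Rightarrow> real) set" where
  "L2_space = {f. f \<in> borel_measurable lebesgue \<and> integrable lebesgue (\<lambda>x. (f x)\<^sup>2)}"

text \<open>Only meaningful on \<^const>\<open>L2_space\<close>: the Bochner integral of a non-integrable function is 0.\<close>
definition L2_norm :: "('a::euclidean_space \<Rightarrow> real) \<Rightarrow> real" where
  "L2_norm f = sqrt (\<integral>x. (f x)\<^sup>2 \<partial>lebesgue)"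

text \<open>Unconditional convergence in \<open>L\<^sup>2\<close>, along the net of finite partial sums.\<close>
definition L2_has_sum :: "('i \<Rightarrow> 'a::euclidean_space \<Rightarrow> real) \<Rightarrow> ('a \<Rightarrow> real) \<Rightarrow> 'i set \<Rightarrow> bool" where
  "L2_has_sum g f I \<longleftrightarrow>
     f \<in> L2_space \<and> (\<forall>i\<in>I. g i \<in> L2_space) \<and>
     ((\<lambda>F. L2_norm (\<lambda>x. f x - (\<Sum>i\<in>F. g i x))) \<longlongrightarrow> 0) (finite_subsets_at_top I)"

definition gradient :: "(real ^ 'd \<Rightarrow> real) \<Rightarrow> real ^ 'd \<Rightarrow> real ^ 'd" where
  "gradient \<sigma> x = (\<chi> i. frechet_derivative \<sigma> (at x) (axis i 1))"

text \<open>The norm of type \<^typ>\<open>real ^ 'd ^ 'd\<close> is the Euclidean norm of the matrix entries.\<close>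
definition hessian :: "(real ^ 'd \<Rightarrow> real) \<Rightarrow> real ^ 'd \<Rightarrow> real ^ 'd ^ 'd" where
  "hessian \<sigma> x = jacobian (gradient \<sigma>) (at x)"

definition twice_differentiable :: "(real ^ 'd \<Rightarrow> real) \<Rightarrow> bool" where
  "twice_differentiable \<sigma> \<longleftrightarrow>
     (\<forall>x. \<sigma> differentiable at x) \<and> (\<forall>x. gradient \<sigma> differentiable at x)"

definition S :: "(real ^ 'd \<Rightarrow> real) \<Rightarrow> int \<Rightarrow> real ^ 'd \<Rightarrow> real ^ 'd \<Rightarrow> real" where
  "S \<sigma> k x b = 2 powi k * \<sigma> ((2 powr (real_of_int k / real CARD('d))) *\<^sub>R (x - b))"

definition \<psi> :: "(real ^ 'd \<Rightarrow> real) \<Rightarrow> int \<Rightarrow> real ^ 'd \<Rightarrow> real ^ 'd \<Rightarrow> real" where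
  "\<psi> \<sigma> k b x = 2 powr (- real_of_int k / 2) * (S \<sigma> k x b - S \<sigma> (k - 1) x b)"

definition \<Lambda> :: "(int \<times> (real ^ 'd)) set" where
  "\<Lambda> = {(k, (2 powr (- real_of_int k / real CARD('d))) *\<^sub>R m) | k m. \<forall>i. m $ i \<in> \<int>}"

definition \<L>\<^sub>1_norm :: "(real ^ 'd \<Rightarrow> real) \<Rightarrow> (real ^ 'd \<Rightarrow> real) \<Rightarrow> ennreal" where
  "\<L>\<^sub>1_norm \<sigma> f =
     Inf {(\<Sum>\<^sub>\<infinity>(k, b)\<in>\<Lambda>. ennreal \<bar>c k b\<bar>) | c :: int \<Rightarrow> real ^ 'd \<Rightarrow> real.
            L2_has_sum (\<lambda>(k, b) x. c k b * \<psi> \<sigma> k b x) f \<Lambda>}"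

definition \<L>\<^sub>1_space :: "(real ^ 'd \<Rightarrow> real) \<Rightarrow> (real ^ 'd \<Rightarrow> real) set" where
  "\<L>\<^sub>1_space \<sigma> = {f \<in> L2_space. \<L>\<^sub>1_norm \<sigma> f < \<infinity>}"

definition activation_dist :: "(real ^ 'd \<Rightarrow> real) \<Rightarrow> (real ^ 'd \<Rightarrow> real) \<Rightarrow> real" where
  "activation_dist \<sigma>1 \<sigma>2 = (1 + 1 / sqrt 2) * L2_norm (\<lambda>x. \<sigma>1 x - \<sigma>2 x)"

text \<open>Shallow scalar-Weight vector-Bias network with \<open>M\<close> neurons, scalar weights \<open>\<gamma>\<close>, vector biases \<open>\<theta>\<close>.\<close>
definition swvb_network ::
  "(real ^ 'd \<Rightarrow> real) \<Rightarrow> nat \<Rightarrow> (nat \<Rightarrow> real) \<Rightarrow> (nat \<Rightarrow> real) \<Rightarrow> (nat \<Rightarrow> real ^ 'd) \<Rightarrow> real ^ 'd \<Rightarrow> real"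
where
  "swvb_network \<sigma> M \<alpha> \<gamma> \<theta> x = (\<Sum>n=1..M. \<alpha> n * \<sigma> (\<gamma> n *\<^sub>R x + \<theta> n))"

end

theory Submission
  imports Defs
begin

text \<open>
  Replace the activation function \<open>\<sigma>\<close> by \<open>\<sigma>\<^sup>\<dagger>\<close> in every selected atom. An atom is linear in its
  activation function and is a combination of two dilates of it, so \<open>N\<close> atoms give \<open>2 N\<close> neurons.
  The factor \<open>2\<^sup>k\<close> of \<open>S\<^sub>k\<close> times the change of variables gives \<open>\<parallel>S\<^sub>k(\<cdot>, b)\<parallel> = 2\<^bsup>k/2\<^esup> \<parallel>\<sigma>\<parallel>\<close>, hence each
  replacement costs at most \<open>(1 + 2\<^bsup>-1/2\<^esup>) \<parallel>\<sigma> - \<sigma>\<^sup>\<dagger>\<parallel>\<close>.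
\<close>

section \<open>Linear structure and triangle inequality of \<open>L2_space\<close>\<close>

lemma L2_spaceI:
  assumes "f \<in> borel_measurable lebesgue" "integrable lebesgue (\<lambda>x. (f x)\<^sup>2)"
  shows "f \<in> L2_space"
  using assms by (simp add: L2_space_def)

lemma L2_space_measurable: "f \<in> L2_space \<Longrightarrow> f \<in> borel_measurable lebesgue"
  and L2_space_integrable: "f \<in> L2_space \<Longrightarrow> integrable lebesgue (\<lambda>x. (f x)\<^sup>2)"
  by (simp_all add: L2_space_def)

lemma L2_norm_nonneg: "0 \<le> L2_norm f"
  by (simp add: L2_norm_def)

lemma L2_norm_power2: "(L2_norm f)\<^sup>2 = (\<integral>x. (f x)\<^sup>2 \<partial>lebesgue)"
  by (simp add: L2_norm_def)

lemma L2_space_zero: "(\<lambda>x. 0) \<in> L2_space"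
  by (simp add: L2_space_def)

lemma L2_norm_zero: "L2_norm (\<lambda>x. 0) = 0"
  by (simp add: L2_norm_def)

lemma L2_space_cmult:
  assumes "f \<in> L2_space"
  shows "(\<lambda>x. c * f x) \<in> L2_space"
  using assms by (auto simp: L2_space_def power_mult_distrib intro: borel_measurable_times)

lemma L2_norm_cmult: "L2_norm (\<lambda>x. c * f x) = \<bar>c\<bar> * L2_norm f"
  by (simp add: L2_norm_def power_mult_distrib real_sqrt_mult)

lemma L2_space_add:
  assumes f: "f \<in> L2_space" and g: "g \<in> L2_space"
  shows "(\<lambda>x. f x + g x) \<in> L2_space"
proof (rule L2_spaceI)
  note [measurable] = L2_space_measurable[OF f] L2_space_measurable[OF g]
  show "(\<lambda>x. f x + g x) \<in> borel_measurable lebesgue"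
    by measurable
  have "integrable lebesgue (\<lambda>x. 2 * (f x)\<^sup>2 + 2 * (g x)\<^sup>2)"
    using L2_space_integrable[OF f] L2_space_integrable[OF g] by simp
  then show "integrable lebesgue (\<lambda>x. (f x + g x)\<^sup>2)"
  proof (rule Bochner_Integration.integrable_bound)
    show "(\<lambda>x. (f x + g x)\<^sup>2) \<in> borel_measurable lebesgue"
      by measurable
    have "(f x + g x)\<^sup>2 \<le> 2 * (f x)\<^sup>2 + 2 * (g x)\<^sup>2" for x
      using sum_squares_bound[of "f x" "g x"] by (simp add: power2_sum)
    then show "AE x in lebesgue. norm ((f x + g x)\<^sup>2) \<le> norm (2 * (f x)\<^sup>2 + 2 * (g x)\<^sup>2)"
      by simp
  qed
qed

lemma L2_space_diff:
  assumes "f \<in> L2_space" "g \<in> L2_space"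
  shows "(\<lambda>x. f x - g x) \<in> L2_space"
  using L2_space_add[OF assms(1) L2_space_cmult[OF assms(2), of "-1"]] by simp

text \<open>
  Integrating \<open>(u + v)\<^sup>2 \<le> (1 + b / a) u\<^sup>2 + (1 + a / b) v\<^sup>2\<close> gives \<open>(a + b)\<^sup>2\<close> for all \<open>a > \<parallel>f\<parallel>\<close> and
  \<open>b > \<parallel>g\<parallel>\<close>; strict bounds avoid a case distinction on vanishing norms.
\<close>
lemma L2_norm_triangle:
  assumes f: "f \<in> L2_space" and g: "g \<in> L2_space"
  shows "L2_norm (\<lambda>x. f x + g x) \<le> L2_norm f + L2_norm g"
proof (rule field_le_epsilon)
  fix e :: real
  assume "0 < e"
  define a b where "a = L2_norm f + e / 2" and "b = L2_norm g + e / 2"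
  have a: "0 < a" "(L2_norm f)\<^sup>2 \<le> a\<^sup>2" and b: "0 < b" "(L2_norm g)\<^sup>2 \<le> b\<^sup>2"
    using \<open>0 < e\<close> L2_norm_nonneg[of f] L2_norm_nonneg[of g]
    by (auto simp: a_def b_def intro!: power_mono)
  have pointwise: "(u + v)\<^sup>2 \<le> (1 + b / a) * u\<^sup>2 + (1 + a / b) * v\<^sup>2" for u v
  proof -
    have "0 \<le> (b * u - a * v)\<^sup>2 / (a * b)"
      using a b by simp
    also have "\<dots> = (1 + b / a) * u\<^sup>2 + (1 + a / b) * v\<^sup>2 - (u + v)\<^sup>2"
      using a b by (simp add: field_simps power2_eq_square)
    finally show ?thesis
      by simp
  qed
  have "(L2_norm (\<lambda>x. f x + g x))\<^sup>2
      \<le> (\<integral>x. (1 + b / a) * (f x)\<^sup>2 + (1 + a / b) * (g x)\<^sup>2 \<partial>lebesgue)"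
    unfolding L2_norm_power2
    using L2_space_integrable[OF L2_space_add[OF f g]]
      L2_space_integrable[OF f] L2_space_integrable[OF g] pointwise
    by (intro integral_mono) auto
  also have "\<dots> = (1 + b / a) * (L2_norm f)\<^sup>2 + (1 + a / b) * (L2_norm g)\<^sup>2"
    using L2_space_integrable[OF f] L2_space_integrable[OF g] by (simp add: L2_norm_power2)
  also have "\<dots> \<le> (1 + b / a) * a\<^sup>2 + (1 + a / b) * b\<^sup>2"
    using a b by (intro add_mono mult_left_mono) auto
  also have "\<dots> = (a + b)\<^sup>2"
    using a b by (simp add: field_simps power2_eq_square)
  finally have "L2_norm (\<lambda>x. f x + g x) \<le> a + b"
    using a b by (meson add_pos_pos less_imp_le power2_le_imp_le)
  then show "L2_norm (\<lambda>x. f x + g x) \<le> L2_norm f + L2_norm g + e"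
    by (simp add: a_def b_def)
qed

text \<open>One induction proves both facts, because applying the triangle inequality to an inserted
  term requires the remaining sum to lie in \<open>L2_space\<close>.\<close>

lemma L2_sum:
  assumes "finite I" "\<And>i. i \<in> I \<Longrightarrow> g i \<in> L2_space"
  shows L2_space_sum: "(\<lambda>x. \<Sum>i\<in>I. g i x) \<in> L2_space"
    and L2_norm_sum_le: "L2_norm (\<lambda>x. \<Sum>i\<in>I. g i x) \<le> (\<Sum>i\<in>I. L2_norm (g i))"
proof -
  have "(\<lambda>x. \<Sum>i\<in>I. g i x) \<in> L2_space \<and> L2_norm (\<lambda>x. \<Sum>i\<in>I. g i x) \<le> (\<Sum>i\<in>I. L2_norm (g i))"
    using assms
  proof (induction I rule: finite_induct)
    case empty
    show ?case
      by (simp add: L2_space_zero L2_norm_zero)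
  next
    case (insert i I)
    then have IH: "(\<lambda>x. \<Sum>i\<in>I. g i x) \<in> L2_space"
        "L2_norm (\<lambda>x. \<Sum>i\<in>I. g i x) \<le> (\<Sum>i\<in>I. L2_norm (g i))"
      and gi: "g i \<in> L2_space"
      by simp_all
    then show ?case
      using insert.hyps L2_space_add[OF gi IH(1)] L2_norm_triangle[OF gi IH(1)] by simp
  qed
  then show "(\<lambda>x. \<Sum>i\<in>I. g i x) \<in> L2_space"
    and "L2_norm (\<lambda>x. \<Sum>i\<in>I. g i x) \<le> (\<Sum>i\<in>I. L2_norm (g i))"
    by simp_all
qed

section \<open>Affine substitutions and the norms of dilates and atoms\<close>

lemma L2_affine:
  fixes g :: "'a::euclidean_space \<Rightarrow> real"
  assumes g: "g \<in> L2_space" and a: "a \<noteq> 0"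
  shows L2_space_affine: "(\<lambda>x. g (a *\<^sub>R x + t)) \<in> L2_space"
    and L2_norm_affine: "L2_norm (\<lambda>x. g (a *\<^sub>R x + t)) = L2_norm g / sqrt (\<bar>a\<bar> ^ DIM('a))"
proof -
  define T where "T = (\<lambda>x::'a. a *\<^sub>R x + t)"
  \<comment> \<open>The change-of-variables theorem for Lebesgue measure scales each coordinate
    separately; here all the factors equal \<open>a\<close>.\<close>
  have T_eq: "T = (\<lambda>x. t + (\<Sum>j\<in>Basis. (a * (x \<bullet> j)) *\<^sub>R j))"
    by (simp add: T_def fun_eq_iff flip: scaleR_scaleR scaleR_sum_right euclidean_representation)
  have T [measurable]: "T \<in> lebesgue \<rightarrow>\<^sub>M lebesgue"
    unfolding T_eq using a by (intro lebesgue_affine_measurable) auto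
  \<comment> \<open>Jacobian formula: integrals of \<open>g\<close> squared are read against this
    density and pulled back along \<open>T\<close>. This gives both integrability and the factor
    \<open>|a| ^ DIM('a)\<close>, whose square root enters the norm.\<close>
  have leb: "lebesgue = density (distr lebesgue lebesgue T) (\<lambda>_. ennreal (\<bar>a\<bar> ^ DIM('a)))"
    using lebesgue_affine_euclidean[of "\<lambda>_. a" t] a unfolding T_eq by (simp add: ennreal_power)
  note [measurable] = L2_space_measurable[OF g]
  have meas: "(\<lambda>x. (g x)\<^sup>2) \<in> borel_measurable (distr lebesgue lebesgue T)"
    by simp
  have "integrable (distr lebesgue lebesgue T) (\<lambda>x. \<bar>a\<bar> ^ DIM('a) *\<^sub>R (g x)\<^sup>2)"
    using L2_space_integrable[OF g] leb meas by (subst (asm) leb, subst (asm) integrable_density) auto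
  then have int: "integrable lebesgue (\<lambda>x. (g (T x))\<^sup>2)"
    using a by (subst (asm) integrable_distr_eq) auto
  have "(\<integral>x. (g x)\<^sup>2 \<partial>lebesgue)
      = (\<integral>x. (g x)\<^sup>2 \<partial>density (distr lebesgue lebesgue T) (\<lambda>_. ennreal (\<bar>a\<bar> ^ DIM('a))))"
    using leb by simp
  also have "\<dots> = \<bar>a\<bar> ^ DIM('a) * (\<integral>x. (g (T x))\<^sup>2 \<partial>lebesgue)"
    using meas by (simp add: integral_density integral_distr)
  finally have "(\<integral>x. (g (T x))\<^sup>2 \<partial>lebesgue) = (\<integral>x. (g x)\<^sup>2 \<partial>lebesgue) / \<bar>a\<bar> ^ DIM('a)"
    using a by (simp add: field_simps)
  then show "L2_norm (\<lambda>x. g (a *\<^sub>R x + t)) = L2_norm g / sqrt (\<bar>a\<bar> ^ DIM('a))"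
    by (simp add: L2_norm_def T_def real_sqrt_divide)
  have "(\<lambda>x. g (T x)) \<in> borel_measurable lebesgue"
    by measurable
  with int show "(\<lambda>x. g (a *\<^sub>R x + t)) \<in> L2_space"
    by (auto simp: T_def intro: L2_spaceI)
qed

text \<open>Puts the argument into the form weight times input plus bias, which fits both
  \<open>L2_affine\<close> and the neurons of \<open>swvb_network\<close>.\<close>

lemma S_affine:
  fixes \<sigma> :: "real ^ 'd \<Rightarrow> real"
  defines "a \<equiv> \<lambda>k. 2 powr (real_of_int k / real CARD('d))"
  shows "S \<sigma> k x b = 2 powi k * \<sigma> (a k *\<^sub>R x + - (a k *\<^sub>R b))"
  by (simp add: S_def a_def algebra_simps)

lemma S_L2:
  fixes \<sigma> :: "real ^ 'd \<Rightarrow> real"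
  assumes "\<sigma> \<in> L2_space"
  shows S_L2_space: "(\<lambda>x. S \<sigma> k x b) \<in> L2_space"
    and L2_norm_S: "L2_norm (\<lambda>x. S \<sigma> k x b) = 2 powr (real_of_int k / 2) * L2_norm \<sigma>"
proof -
  define a :: real where "a = 2 powr (real_of_int k / real CARD('d))"
  have a: "a \<noteq> 0" "0 < a"
    by (simp_all add: a_def)
  have S: "(\<lambda>x. S \<sigma> k x b) = (\<lambda>x. 2 powi k * \<sigma> (a *\<^sub>R x + - (a *\<^sub>R b)))"
    by (simp add: S_affine a_def)
  show "(\<lambda>x. S \<sigma> k x b) \<in> L2_space"
    unfolding S by (intro L2_space_cmult L2_space_affine assms a)
  \<comment> \<open>The exponent \<open>k / d\<close> in the dilation makes the Jacobian exactly
    \<open>2 powr k\<close> in every dimension.\<close>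
  have "\<bar>a\<bar> ^ DIM(real ^ 'd) = 2 powr real_of_int k"
    using a by (simp add: a_def powr_powr flip: powr_realpow)
  then have sqrt_a: "sqrt (\<bar>a\<bar> ^ DIM(real ^ 'd)) = 2 powr (real_of_int k / 2)"
    by (simp add: powr_half_sqrt_powr)
  \<comment> \<open>One of the two factors cancels the denominator coming from
    \<open>L2_norm_affine\<close>.\<close>
  have "2 powi k = (2::real) powr (real_of_int k / 2) * 2 powr (real_of_int k / 2)"
    by (simp add: powr_real_of_int' flip: powr_add)
  then show "L2_norm (\<lambda>x. S \<sigma> k x b) = 2 powr (real_of_int k / 2) * L2_norm \<sigma>"
    unfolding S L2_norm_cmult L2_norm_affine[OF assms a(1)] sqrt_a by simp
qed

text \<open>The prefactor of \<open>\<psi>\<close> cancels the growth of the norm of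
  \<open>S\<close> at scale \<open>k\<close>, and scale \<open>k - 1\<close> has a norm smaller by
  the factor \<open>1 / sqrt 2\<close>. Hence the bound is uniform in \<open>k\<close> and
  \<open>b\<close>, with the constant of \<open>activation_dist\<close>.\<close>

lemma \<psi>_L2:
  fixes \<sigma> :: "real ^ 'd \<Rightarrow> real"
  assumes "\<sigma> \<in> L2_space"
  shows \<psi>_L2_space: "\<psi> \<sigma> k b \<in> L2_space"
    and L2_norm_\<psi>_le: "L2_norm (\<psi> \<sigma> k b) \<le> (1 + 1 / sqrt 2) * L2_norm \<sigma>"
proof -
  have \<psi>: "\<psi> \<sigma> k b = (\<lambda>x. 2 powr (- real_of_int k / 2) * (S \<sigma> k x b + (-1) * S \<sigma> (k - 1) x b))"
    by (simp add: \<psi>_def fun_eq_iff)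
  have L2: "(\<lambda>x. S \<sigma> k x b) \<in> L2_space" "(\<lambda>x. (-1) * S \<sigma> (k - 1) x b) \<in> L2_space"
    by (intro L2_space_cmult S_L2_space assms)+
  show "\<psi> \<sigma> k b \<in> L2_space"
    unfolding \<psi> by (intro L2_space_cmult L2_space_add L2)
  have "(2::real) powr (real_of_int (k - 1) / 2) = 2 powr (real_of_int k / 2) * 2 powr (- (1 / 2))"
    by (simp add: diff_divide_distrib flip: powr_add)
  then have half: "(2::real) powr (real_of_int (k - 1) / 2) = 2 powr (real_of_int k / 2) * (1 / sqrt 2)"
    by (simp add: powr_minus powr_half_sqrt inverse_eq_divide)
  have "L2_norm (\<psi> \<sigma> k b) \<le> 2 powr (- real_of_int k / 2) *
      (L2_norm (\<lambda>x. S \<sigma> k x b) + L2_norm (\<lambda>x. (-1) * S \<sigma> (k - 1) x b))"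
    unfolding \<psi> L2_norm_cmult[of "2 powr _"] using L2_norm_triangle[OF L2]
    by (intro mult_mono) (auto intro: L2_norm_nonneg)
  also have "\<dots> = (2 powr (- real_of_int k / 2) * 2 powr (real_of_int k / 2))
      * ((1 + 1 / sqrt 2) * L2_norm \<sigma>)"
    unfolding L2_norm_cmult L2_norm_S[OF assms] half by (simp add: algebra_simps)
  also have "\<dots> = (1 + 1 / sqrt 2) * L2_norm \<sigma>"
    by (simp flip: powr_add)
  finally show "L2_norm (\<psi> \<sigma> k b) \<le> (1 + 1 / sqrt 2) * L2_norm \<sigma>" .
qed

text \<open>The error of exchanging activation functions is itself an atom, so
  \<open>L2_norm_\<psi>_le\<close> applies to it.\<close>

lemma \<psi>_diff: "\<psi> \<sigma> k b x - \<psi> \<tau> k b x = \<psi> (\<lambda>x. \<sigma> x - \<tau> x) k b x"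
  by (simp add: \<psi>_def S_def algebra_simps)

section \<open>Finite sums of atoms as networks\<close>

lemma swvb_network_of_finite_sum:
  assumes "finite I" "card I \<le> M"
  shows "\<exists>\<gamma> \<alpha> \<theta>. \<forall>\<sigma> x. swvb_network \<sigma> M \<alpha> \<gamma> \<theta> x = (\<Sum>i\<in>I. w i * \<sigma> (g i *\<^sub>R x + t i))"
proof -
  obtain h where h: "bij_betw h {1..card I} I"
    using ex_bij_betw_nat_finite_1[OF assms(1)] by blast
  \<comment> \<open>Beyond \<open>card I\<close> nothing is known about \<open>h\<close>; outer
    weight 0 silences these spare neurons whatever their inner weights and biases are.\<close>
  define \<alpha> where "\<alpha> n = (if n \<le> card I then w (h n) else 0)" for n
  have "swvb_network \<sigma> M \<alpha> (g \<circ> h) (t \<circ> h) x = (\<Sum>i\<in>I. w i * \<sigma> (g i *\<^sub>R x + t i))" for \<sigma> x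
  proof -
    have "swvb_network \<sigma> M \<alpha> (g \<circ> h) (t \<circ> h) x
        = (\<Sum>n=1..card I. \<alpha> n * \<sigma> (g (h n) *\<^sub>R x + t (h n)))"
      unfolding swvb_network_def o_def using assms(2)
      by (intro sum.mono_neutral_right) (auto simp: \<alpha>_def)
    also have "\<dots> = (\<Sum>n=1..card I. w (h n) * \<sigma> (g (h n) *\<^sub>R x + t (h n)))"
      by (simp add: \<alpha>_def)
    also have "\<dots> = (\<Sum>i\<in>I. w i * \<sigma> (g i *\<^sub>R x + t i))"
      by (rule sum.reindex_bij_betw[OF h])
    finally show ?thesis .
  qed
  then show ?thesis
    by blast
qed

lemma swvb_network_of_atoms:
  fixes F :: "(int \<times> (real ^ 'd)) set"
  assumes "finite F" "card F \<le> N"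
  shows "\<exists>\<gamma> \<alpha> \<theta>. \<forall>\<sigma> x. swvb_network \<sigma> (2 * N) \<alpha> \<gamma> \<theta> x = (\<Sum>(k, b)\<in>F. w k b * \<psi> \<sigma> k b x)"
proof -
  define a :: "int \<Rightarrow> real" where "a k = 2 powr (real_of_int k / real CARD('d))" for k
  \<comment> \<open>Each atom yields two neurons, tagged by \<open>s\<close> in
    \<open>{0, 1}\<close>: the tag selects the scale \<open>k - s\<close>, and
    \<open>(-1) ^ s\<close> is the sign of that scale in \<open>\<psi>\<close>.\<close>
  define v :: "(int \<times> (real ^ 'd)) \<times> nat \<Rightarrow> real"
    where "v = (\<lambda>((k, b), s). w k b * 2 powr (- real_of_int k / 2) * (-1) ^ s * 2 powi (k - int s))"
  define g :: "(int \<times> (real ^ 'd)) \<times> nat \<Rightarrow> real" where "g = (\<lambda>((k, b), s). a (k - int s))"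
  define t :: "(int \<times> (real ^ 'd)) \<times> nat \<Rightarrow> real ^ 'd"
    where "t = (\<lambda>((k, b), s). - (a (k - int s) *\<^sub>R b))"
  have "(\<Sum>i\<in>F \<times> {0, 1}. v i * \<sigma> (g i *\<^sub>R x + t i)) = (\<Sum>(k, b)\<in>F. w k b * \<psi> \<sigma> k b x)" for \<sigma> x
  proof -
    have "(\<Sum>i\<in>F \<times> {0, 1}. v i * \<sigma> (g i *\<^sub>R x + t i))
        = (\<Sum>j\<in>F. \<Sum>s\<in>{0, 1}. v (j, s) * \<sigma> (g (j, s) *\<^sub>R x + t (j, s)))"
      by (simp add: sum.cartesian_product')
    also have "\<dots> = (\<Sum>(k, b)\<in>F. w k b * \<psi> \<sigma> k b x)"
      by (auto simp: \<psi>_def S_affine v_def g_def t_def a_def algebra_simps intro!: sum.cong)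
    finally show ?thesis .
  qed
  moreover have "finite (F \<times> {0, 1::nat})" "card (F \<times> {0, 1::nat}) \<le> 2 * N"
    using assms by (simp_all add: card_cartesian_product)
  ultimately show ?thesis
    using swvb_network_of_finite_sum[of "F \<times> {0, 1}" "2 * N" v g t] by simp
qed

text \<open>The square of \<open>f\<close> is dominated by \<open>B\<close> times its absolute
  value. This serves to place \<open>\<sigma>\<close> in \<open>L2_space\<close>.\<close>

lemma L2_space_of_bounded_integrable:
  assumes "integrable lebesgue f" "\<And>x. \<bar>f x\<bar> \<le> B"
  shows "f \<in> L2_space"
proof (rule L2_spaceI)
  show f [measurable]: "f \<in> borel_measurable lebesgue"
    using assms(1) by (rule borel_measurable_integrable)
  have "integrable lebesgue (\<lambda>x. B * \<bar>f x\<bar>)"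
    using assms(1) by simp
  then show "integrable lebesgue (\<lambda>x. (f x)\<^sup>2)"
  proof (rule Bochner_Integration.integrable_bound)
    show "(\<lambda>x. (f x)\<^sup>2) \<in> borel_measurable lebesgue"
      by measurable
    have "(f x)\<^sup>2 \<le> \<bar>B * \<bar>f x\<bar>\<bar>" for x
      using mult_right_mono[OF assms(2)[of x], of "\<bar>f x\<bar>"]
      by (metis abs_ge_self abs_ge_zero abs_mult_self_eq order_trans power2_eq_square)
    then show "AE x in lebesgue. norm ((f x)\<^sup>2) \<le> norm (B * \<bar>f x\<bar>)"
      by simp
  qed
qed

theorem corollary4p2:
  fixes \<sigma> \<sigma>' f f\<^sub>N :: "real ^ 'd \<Rightarrow> real"
    and c C' \<epsilon> :: real
    and N :: nat
    and \<chi>\<^sub>N coef :: "int \<Rightarrow> real ^ 'd \<Rightarrow> real"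
  assumes "c > 0"
    and "0 < \<epsilon>" and "\<epsilon> \<le> 1 / real CARD('d)"
    and "twice_differentiable \<sigma>"
    and "has_bochner_integral lebesgue \<sigma> 1"
    and "\<And>x. \<sigma> (- x) = \<sigma> x"
    and "C' > 0"
    and "\<And>x. norm (\<sigma> x) \<le> C' / (inverse c + norm x ^ CARD('d)) powr (1 + \<epsilon>)"
    and "\<And>x. norm (gradient \<sigma> x)
              \<le> C' / (inverse c + norm x ^ CARD('d)) powr (1 + \<epsilon> + 1 / real CARD('d))"
    and "\<And>x. norm (hessian \<sigma> x)
              \<le> C' / (inverse c + norm x ^ CARD('d)) powr (1 + \<epsilon> + 2 / real CARD('d))"
    and "\<sigma>' \<in> L2_space"
    and "f \<in> \<L>\<^sub>1_space \<sigma>"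
    and "\<And>k b. (k, b) \<in> \<Lambda> \<Longrightarrow> \<chi>\<^sub>N k b \<in> {0, 1}"
    and "finite {(k, b) \<in> \<Lambda>. \<chi>\<^sub>N k b = 1}" and "card {(k, b) \<in> \<Lambda>. \<chi>\<^sub>N k b = 1} \<le> N"
    and "f\<^sub>N = (\<lambda>x. \<Sum>\<^sub>\<infinity>(k, b)\<in>\<Lambda>. \<chi>\<^sub>N k b * coef k b * \<psi> \<sigma> k b x)"
    and "L2_norm (\<lambda>x. f x - f\<^sub>N x) \<le> enn2real (\<L>\<^sub>1_norm \<sigma> f) * real (N + 1) powr (- 1 / 2)"
  shows "\<exists>(\<gamma> :: nat \<Rightarrow> real) (\<alpha> :: nat \<Rightarrow> real) (\<theta> :: nat \<Rightarrow> real ^ 'd).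
           swvb_network \<sigma>' (2 * N) \<alpha> \<gamma> \<theta> \<in> L2_space \<and>
           L2_norm (\<lambda>x. f x - swvb_network \<sigma>' (2 * N) \<alpha> \<gamma> \<theta> x)
             \<le> enn2real (\<L>\<^sub>1_norm \<sigma> f) * real (N + 1) powr (- 1 / 2)
               + activation_dist \<sigma> \<sigma>' * (\<Sum>\<^sub>\<infinity>(k, b)\<in>\<Lambda>. \<chi>\<^sub>N k b * \<bar>coef k b\<bar>)"
proof -
  define T where "T = {(k, b) \<in> \<Lambda>. \<chi>\<^sub>N k b = 1}"
  have T: "finite T" "card T \<le> N"
    using assms(14,15) by (auto simp: T_def)
  \<comment> \<open>Outside \<open>T\<close> the selector vanishes on \<open>\<Lambda>\<close>, so
    the sum is finite. It is needed twice: pointwise for \<open>f\<^sub>N\<close>, and for the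
    absolute values of the coefficients.\<close>
  have sum_T: "(\<Sum>\<^sub>\<infinity>(k, b)\<in>\<Lambda>. \<chi>\<^sub>N k b * h k b) = (\<Sum>(k, b)\<in>T. h k b)"
    for h :: "int \<Rightarrow> real ^ 'd \<Rightarrow> real"
  proof -
    have "(\<Sum>\<^sub>\<infinity>(k, b)\<in>\<Lambda>. \<chi>\<^sub>N k b * h k b) = (\<Sum>\<^sub>\<infinity>(k, b)\<in>T. h k b)"
      using assms(13) by (intro infsum_cong_neutral) (fastforce simp: T_def)+
    then show ?thesis
      using T(1) by simp
  qed
  obtain \<gamma> \<alpha> \<theta> where net:
    "\<And>x. swvb_network \<sigma>' (2 * N) \<alpha> \<gamma> \<theta> x = (\<Sum>(k, b)\<in>T. coef k b * \<psi> \<sigma>' k b x)"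
    using swvb_network_of_atoms[OF T(1,2)] by blast
  let ?\<Psi> = "swvb_network \<sigma>' (2 * N) \<alpha> \<gamma> \<theta>"
  have f_N: "f\<^sub>N x = (\<Sum>(k, b)\<in>T. coef k b * \<psi> \<sigma> k b x)" for x
    unfolding assms(16) using sum_T[of "\<lambda>k b. coef k b * \<psi> \<sigma> k b x"] by (simp add: mult.assoc)

  \<comment> \<open>The decay bound is largest at the origin, where its denominator is smallest; its
    value there bounds \<open>\<sigma>\<close> everywhere.\<close>
  have "\<bar>\<sigma> x\<bar> \<le> C' / inverse c powr (1 + \<epsilon>)" for x
  proof -
    have pos: "0 < inverse c + norm x ^ CARD('d)"
      using assms(1) by (simp add: add_pos_nonneg)
    have "\<bar>\<sigma> x\<bar> \<le> C' / (inverse c + norm x ^ CARD('d)) powr (1 + \<epsilon>)"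
      using assms(8)[of x] by simp
    also have "\<dots> \<le> C' / inverse c powr (1 + \<epsilon>)"
      using pos assms(1,2,7) by (intro divide_left_mono powr_mono2 mult_pos_pos) auto
    finally show ?thesis .
  qed
  then have \<sigma>: "\<sigma> \<in> L2_space"
    using assms(5) by (intro L2_space_of_bounded_integrable) (auto simp: has_bochner_integral_iff)
  have f: "f \<in> L2_space"
    using assms(12) by (simp add: \<L>\<^sub>1_space_def)

  \<comment> \<open>The \<open>case\<close> stands outside the abstraction over \<open>x\<close> to
    match the indexed family \<open>g i\<close> of \<open>L2_space_sum\<close>.\<close>
  have atoms: "(\<lambda>x. \<Sum>i\<in>T. (case i of (k, b) \<Rightarrow> \<lambda>x. coef k b * \<psi> \<tau> k b x) x) \<in> L2_space"
    if "\<tau> \<in> L2_space" for \<tau>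
    using T(1) that by (intro L2_space_sum) (auto intro: L2_space_cmult \<psi>_L2_space)
  have f\<^sub>N: "f\<^sub>N \<in> L2_space"
    using atoms[OF \<sigma>] by (simp add: f_N[abs_def] split_def)
  \<comment> \<open>This gives content to the final bound, as \<open>L2_norm\<close> takes the
    default value 0 on measurable functions that are not square-integrable.\<close>
  have \<Psi>: "?\<Psi> \<in> L2_space"
    using atoms[OF assms(11)] by (simp add: net[abs_def] split_def)

  let ?\<rho> = "\<lambda>x. \<sigma> x - \<sigma>' x"
  have \<rho>: "?\<rho> \<in> L2_space"
    by (rule L2_space_diff[OF \<sigma> assms(11)])
  \<comment> \<open>Both sums run over \<open>T\<close> with the same coefficients, so by
    \<open>\<psi>_diff\<close> their difference is a combination of atoms of
    \<open>\<sigma> - \<sigma>'\<close>.\<close>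
  have "L2_norm (\<lambda>x. f\<^sub>N x - ?\<Psi> x)
      = L2_norm (\<lambda>x. \<Sum>i\<in>T. (case i of (k, b) \<Rightarrow> \<lambda>x. coef k b * \<psi> ?\<rho> k b x) x)"
    by (simp add: f_N net split_def flip: sum_subtractf right_diff_distrib \<psi>_diff)
  also have "\<dots> \<le> (\<Sum>i\<in>T. L2_norm (case i of (k, b) \<Rightarrow> \<lambda>x. coef k b * \<psi> ?\<rho> k b x))"
    using T(1) \<rho> by (intro L2_norm_sum_le) (auto intro: L2_space_cmult \<psi>_L2_space)
  also have "\<dots> \<le> (\<Sum>(k, b)\<in>T. activation_dist \<sigma> \<sigma>' * \<bar>coef k b\<bar>)"
  proof (intro sum_mono, clarify)
    fix k b
    show "L2_norm (\<lambda>x. coef k b * \<psi> ?\<rho> k b x) \<le> activation_dist \<sigma> \<sigma>' * \<bar>coef k b\<bar>"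
      using mult_left_mono[OF L2_norm_\<psi>_le[OF \<rho>, of k b] abs_ge_zero[of "coef k b"]]
      by (simp add: L2_norm_cmult activation_dist_def mult.commute)
  qed
  also have "\<dots> = activation_dist \<sigma> \<sigma>' * (\<Sum>\<^sub>\<infinity>(k, b)\<in>\<Lambda>. \<chi>\<^sub>N k b * \<bar>coef k b\<bar>)"
    unfolding sum_T by (simp add: sum_distrib_left split_def)
  finally have "L2_norm (\<lambda>x. f\<^sub>N x - ?\<Psi> x)
      \<le> activation_dist \<sigma> \<sigma>' * (\<Sum>\<^sub>\<infinity>(k, b)\<in>\<Lambda>. \<chi>\<^sub>N k b * \<bar>coef k b\<bar>)" .
  \<comment> \<open>Triangle inequality through \<open>f\<^sub>N\<close>: the assumed approximation
    error plus the cost of exchanging the activation function.\<close>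
  then have "L2_norm (\<lambda>x. f x - ?\<Psi> x) \<le> enn2real (\<L>\<^sub>1_norm \<sigma> f) * real (N + 1) powr (- 1 / 2)
      + activation_dist \<sigma> \<sigma>' * (\<Sum>\<^sub>\<infinity>(k, b)\<in>\<Lambda>. \<chi>\<^sub>N k b * \<bar>coef k b\<bar>)"
    using L2_norm_triangle[OF L2_space_diff[OF f f\<^sub>N] L2_space_diff[OF f\<^sub>N \<Psi>]] assms(17) by simp
  with \<Psi> show ?thesis
    by blast
qed

end
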